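(* Let $\lambda=(\lambda_1,\ldots,\lambda_n)\in\mathbb{Z}^n$ be a composition and let $\lambda0:=(\lambda_1,\ldots,\lambda_n,0)$. Then $Q_{\lambda0}=Q_\lambda$.
   Context: Let $x_1,x_2,\ldots$ be variables and define symmetric functions $q_n$ ($n\in\mathbb{Z}$) by $\prod_{i\ge1}\frac{1+zx_i}{1-zx_i}=\sum_{n\in\mathbb{Z}}q_nz^n$; so $q_0=1$ and $q_n=0$ for $n<0$. For $r,s\in\mathbb{Z}$ put $Q_{(r,s)}:=q_rq_s+2\sum_{i=1}^s(-1)^iq_{r+i}q_{s-i}$ (the sum is empty if $s<1$). A composition is a finite sequence of (possibly negative) integers. For a composition $\nu=(\nu_1,\ldots,\nu_N)$ let $M(\nu)$ be the $N\times N$ skew-symmetric matrix with $ij$-entry $Q_{(\nu_i,\nu_j)}$ if $i<j$, $0$ if $i=j$, and $-Q_{(\nu_j,\nu_i)}$ if $i>j$. For any composition $\lambda\in\mathbb{Z}^n$ define $Q_\lambda:=\operatorname{Pf}M(\lambda)$ if $n$ is even and $Q_\lambda:=\operatorname{Pf}M(\lambda0)$ if $n$ is odd. Here $\operatorname{Pf}$ is the Pfaffian, normalized by $\operatorname{Pf}M=\sum_{j=2}^{2N}(-1)^jm_{1j}\operatorname{Pf}M_{1j}$, where $M_{1j}$ is $M$ with rows and columns $1,j$ deleted; the empty Pfaffian is $1$. *)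

theory Defs
  imports
    "HOL-Analysis.Analysis"
    "HOL-Computational_Algebra.Formal_Power_Series"
    "HOL-Library.Poly_Mapping"
    "Jordan_Normal_Form.Determinant"
begin

section \<open>Formal power series in the variables $x_0, x_1, x_2, \ldots$\<close>

text \<open>
  Symmetric functions in infinitely many variables are infinite sums of monomials, so polynomial
  rings do not contain them. A formal power series assigns an arbitrary coefficient to each
  monomial; the monomial with exponents \<open>m\<close> is encoded as a finitely supported \<open>m :: nat \<Rightarrow>\<^sub>0 nat\<close>.
\<close>

typedef 'a mfps = "UNIV :: ((nat \<Rightarrow>\<^sub>0 nat) \<Rightarrow> 'a) set"
  morphisms mfps_coeff Abs_mfps by simp

setup_lifting type_definition_mfps

lemma mfps_eqI: "(\<And>m. mfps_coeff f m = mfps_coeff g m) \<Longrightarrow> f = g"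
  by transfer auto

lemma finite_splittings: "finite {(a, b). a + b = (m :: nat \<Rightarrow>\<^sub>0 nat)}"
proof -
  have key: "Poly_Mapping.lookup a \<in> {g. \<forall>x. (x \<in> Poly_Mapping.keys m \<longrightarrow> g x \<in> {..Max (range (Poly_Mapping.lookup m))}) \<and> (x \<notin> Poly_Mapping.keys m \<longrightarrow> g x = 0)}"
    if "a + b = m" for a b :: "nat \<Rightarrow>\<^sub>0 nat"
  proof -
    have le: "Poly_Mapping.lookup a x \<le> Poly_Mapping.lookup m x" for x
      using that by (auto simp: Poly_Mapping.lookup_add)
    have fin: "finite (range (Poly_Mapping.lookup m))"
      by (rule finite_subset[of _ "insert 0 (Poly_Mapping.lookup m ` Poly_Mapping.keys m)"]) (auto simp: in_keys_iff)
    have "Poly_Mapping.lookup a x \<le> Max (range (Poly_Mapping.lookup m))" for x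
      using le[of x] Max_ge[OF fin, of "Poly_Mapping.lookup m x"] by simp
    moreover have "Poly_Mapping.lookup a x = 0" if "x \<notin> Poly_Mapping.keys m" for x
      using le[of x] that by (simp add: in_keys_iff)
    ultimately show ?thesis by simp
  qed
  have "finite (Poly_Mapping.lookup ` fst ` {(a, b). a + b = m})"
    by (rule finite_subset[OF _ finite_set_of_finite_funs[of "Poly_Mapping.keys m" "{..Max (range (Poly_Mapping.lookup m))}" 0]])
      (use key in auto)
  hence f: "finite (fst ` {(a, b). a + b = m})"
    by (rule finite_imageD) (auto simp: inj_on_def lookup_inject)
  show ?thesis
    by (rule finite_imageD[OF f]) (auto simp: inj_on_def)
qed

instantiation mfps :: (comm_ring_1) comm_ring_1
begin

lift_definition zero_mfps :: "'a mfps" is "\<lambda>_. 0" .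
lift_definition one_mfps :: "'a mfps" is "\<lambda>m. if m = 0 then 1 else 0" .
lift_definition plus_mfps :: "'a mfps \<Rightarrow> 'a mfps \<Rightarrow> 'a mfps" is "\<lambda>f g m. f m + g m" .
lift_definition minus_mfps :: "'a mfps \<Rightarrow> 'a mfps \<Rightarrow> 'a mfps" is "\<lambda>f g m. f m - g m" .
lift_definition uminus_mfps :: "'a mfps \<Rightarrow> 'a mfps" is "\<lambda>f m. - f m" .
lift_definition times_mfps :: "'a mfps \<Rightarrow> 'a mfps \<Rightarrow> 'a mfps"
  is "\<lambda>f g m. \<Sum>(a, b) | a + b = m. f a * g b" .

instance
proof
  fix f g h :: "'a mfps"
  show "f * g * h = f * (g * h)"
  proof transfer
    fix f g h :: "(nat \<Rightarrow>\<^sub>0 nat) \<Rightarrow> 'a"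
    show "(\<lambda>m. \<Sum>(a, b) | a + b = m. (\<Sum>(c, d) | c + d = a. f c * g d) * h b) =
          (\<lambda>m. \<Sum>(a, b) | a + b = m. f a * (\<Sum>(c, d) | c + d = b. g c * h d))"
    proof
      fix m :: "nat \<Rightarrow>\<^sub>0 nat"
      have "(\<Sum>(a, b) | a + b = m. (\<Sum>(c, d) | c + d = a. f c * g d) * h b) =
            (\<Sum>p \<in> {(a, b). a + b = m}. \<Sum>r \<in> {(c, d). c + d = fst p}. f (fst r) * g (snd r) * h (snd p))"
        by (simp add: sum_distrib_right case_prod_beta)
      also have "\<dots> = (\<Sum>z \<in> (SIGMA p : {(a, b). a + b = m}. {(c, d). c + d = fst p}).
            f (fst (snd z)) * g (snd (snd z)) * h (snd (fst z)))"
        by (subst sum.Sigma) (auto simp: finite_splittings case_prod_beta)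
      also have "\<dots> = (\<Sum>z \<in> (SIGMA p : {(a, b). a + b = m}. {(c, d). c + d = snd p}).
            f (fst (fst z)) * (g (fst (snd z)) * h (snd (snd z))))"
        by (rule sum.reindex_bij_witness[where
              i = "\<lambda>((a, b), (c, d)). ((a + c, d), (a, c))" and
              j = "\<lambda>((a, b), (c, d)). ((c, d + b), (d, b))"])
          (auto simp: add.assoc mult.assoc)
      also have "\<dots> = (\<Sum>p \<in> {(a, b). a + b = m}. \<Sum>r \<in> {(c, d). c + d = snd p}.
            f (fst p) * (g (fst r) * h (snd r)))"
        by (subst sum.Sigma) (auto simp: finite_splittings case_prod_beta)
      also have "\<dots> = (\<Sum>(a, b) | a + b = m. f a * (\<Sum>(c, d) | c + d = b. g c * h d))"
        by (simp add: sum_distrib_left case_prod_beta)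
      finally show "(\<Sum>(a, b) | a + b = m. (\<Sum>(c, d) | c + d = a. f c * g d) * h b) =
          (\<Sum>(a, b) | a + b = m. f a * (\<Sum>(c, d) | c + d = b. g c * h d))" .
    qed
  qed
  show "f * g = g * f"
  proof (transfer, rule ext)
    fix f g :: "(nat \<Rightarrow>\<^sub>0 nat) \<Rightarrow> 'a" and m
    show "(\<Sum>(a, b) | a + b = m. f a * g b) = (\<Sum>(a, b) | a + b = m. g a * f b)"
      by (rule sum.reindex_bij_witness[where i = prod.swap and j = prod.swap])
        (auto simp: add.commute mult.commute)
  qed
  show "1 * f = f"
  proof (transfer, rule ext)
    fix f :: "(nat \<Rightarrow>\<^sub>0 nat) \<Rightarrow> 'a" and m
    have "(\<Sum>(a, b) | a + b = m. (if a = 0 then 1 else 0) * f b) =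
          (\<Sum>(a, b) \<in> {(0 :: nat \<Rightarrow>\<^sub>0 nat, m)}. (if a = 0 then 1 else 0) * f b)"
      by (rule sum.mono_neutral_right) (auto simp: finite_splittings split: if_splits)
    thus "(\<Sum>(a, b) | a + b = m. (if a = 0 then 1 else 0) * f b) = f m"
      by simp
  qed
  show "(f + g) * h = f * h + g * h"
    by transfer (auto simp: distrib_right case_prod_beta sum.distrib)
  show "(0 :: 'a mfps) \<noteq> 1"
    by transfer (auto dest: fun_cong[where x = 0])
qed (transfer; auto simp: algebra_simps)+

end

lift_definition mfps_var :: "nat \<Rightarrow> 'a :: comm_ring_1 mfps"
  is "\<lambda>i m. if m = Poly_Mapping.single i 1 then 1 else 0" .


section \<open>The symmetric functions $q_n$\<close>

text \<open>The factor $(1 + z x_i) / (1 - z x_i)$ as a power series in $z$.\<close>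

definition q_factor :: "nat \<Rightarrow> int mfps fps" where
  "q_factor i = (1 + fps_const (mfps_var i) * fps_X) *
     fps_right_inverse (1 - fps_const (mfps_var i) * fps_X) 1"

lemma q_factor: "(1 - fps_const (mfps_var i) * fps_X) * q_factor i = 1 + fps_const (mfps_var i) * fps_X"
proof -
  have "(1 - fps_const (mfps_var i) * fps_X) *
      fps_right_inverse (1 - fps_const (mfps_var i) * fps_X) 1 = (1 :: int mfps fps)"
    by (rule fps_right_inverse) simp
  thus ?thesis
    unfolding q_factor_def by (subst mult.left_commute) simp
qed

text \<open>
  The infinite product is understood coefficientwise: each coefficient of the partial products is
  an eventually constant sequence of integers (lemma \<open>q_gen_LIMSEQ\<close>), so its limit in \<open>int\<close>
  is that eventual value.
\<close>

definition q_gen :: "int mfps fps" where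
  "q_gen = Abs_fps (\<lambda>n. Abs_mfps (\<lambda>m. lim (\<lambda>N. mfps_coeff (fps_nth (\<Prod>i<N. q_factor i) n) m)))"

definition q_sym :: "int \<Rightarrow> int mfps" where
  "q_sym n = (if n < 0 then 0 else fps_nth q_gen (nat n))"

lemma mfps_coeff_var_mult:
  assumes "i \<notin> Poly_Mapping.keys m"
  shows "mfps_coeff (mfps_var i * f) m = 0"
  using assms
proof transfer
  fix i and m :: "nat \<Rightarrow>\<^sub>0 nat" and f :: "(nat \<Rightarrow>\<^sub>0 nat) \<Rightarrow> 'a"
  assume i: "i \<notin> Poly_Mapping.keys m"
  have "a \<noteq> Poly_Mapping.single i 1" if "a + b = m" for a b :: "nat \<Rightarrow>\<^sub>0 nat"
  proof
    assume "a = Poly_Mapping.single i 1"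
    hence "Poly_Mapping.lookup m i \<ge> 1" using that by (auto simp: Poly_Mapping.lookup_add)
    thus False using i by (simp add: in_keys_iff)
  qed
  thus "(\<Sum>(a, b) | a + b = m. (if a = Poly_Mapping.single i 1 then 1 else 0) * f b) = 0"
    by (intro sum.neutral ballI) (simp add: case_prod_beta)
qed

lemma q_gen_LIMSEQ:
  "(\<lambda>N. mfps_coeff (fps_nth (\<Prod>i<N. q_factor i) n) m) \<longlonglongrightarrow> mfps_coeff (fps_nth q_gen n) m"
proof -
  let ?c = "\<lambda>N. mfps_coeff (fps_nth (\<Prod>i<N. q_factor i) n) m"
  have const: "?c (Suc N) = ?c N" if "N \<notin> Poly_Mapping.keys m" for N
  proof -
    let ?x = "fps_const (mfps_var N :: int mfps)"
    let ?P = "\<Prod>i<N. q_factor i"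
    have "q_factor N = (1 - ?x * fps_X) * q_factor N + ?x * fps_X * q_factor N"
      by (simp add: left_diff_distrib)
    also have "\<dots> = 1 + ?x * (fps_X * (1 + q_factor N))"
      unfolding q_factor by (simp add: distrib_left mult.assoc)
    finally have "?P * q_factor N = ?P * (1 + ?x * (fps_X * (1 + q_factor N)))"
      by (rule arg_cong)
    also have "\<dots> = ?P + ?x * (?P * (fps_X * (1 + q_factor N)))"
      by (subst distrib_left) (simp only: mult_1_right mult.left_commute)
    finally have "(\<Prod>i<Suc N. q_factor i) = ?P + ?x * (?P * (fps_X * (1 + q_factor N)))"
      unfolding prod.lessThan_Suc .
    hence "fps_nth (\<Prod>i<Suc N. q_factor i) n =
        fps_nth (?P + ?x * (?P * (fps_X * (1 + q_factor N)))) n"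
      by (rule arg_cong)
    also have "\<dots> = fps_nth ?P n + mfps_var N * fps_nth (?P * (fps_X * (1 + q_factor N))) n"
      by (simp only: fps_add_nth fps_mult_left_const_nth)
    finally have "?c (Suc N) = mfps_coeff (fps_nth ?P n + mfps_var N * fps_nth (?P * (fps_X * (1 + q_factor N))) n) m"
      by (rule arg_cong)
    also have "\<dots> = ?c N"
      by (simp only: plus_mfps.rep_eq mfps_coeff_var_mult[OF that] add_0_right)
    finally show ?thesis .
  qed
  obtain K where K: "\<And>N. N \<in> Poly_Mapping.keys m \<Longrightarrow> N < K"
    using finite_nat_set_iff_bounded[of "Poly_Mapping.keys m"] by auto
  have "?c N = ?c K" if "N \<ge> K" for N
    using that
  proof (induction rule: dec_induct)
    case (step N)
    have "N \<notin> Poly_Mapping.keys m" using K[of N] step.hyps by auto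
    from const[OF this] step.IH show ?case by (rule trans)
  qed (rule refl)
  hence ev: "\<forall>\<^sub>F N in sequentially. ?c N = ?c K"
    unfolding eventually_sequentially by blast
  have lim: "?c \<longlonglongrightarrow> ?c K"
    by (rule tendsto_eventually[OF ev])
  have "mfps_coeff (fps_nth q_gen n) m = lim ?c"
    unfolding q_gen_def fps_nth_Abs_fps by (rule Abs_mfps_inverse[OF UNIV_I, THEN fun_cong])
  also have "\<dots> = ?c K"
    by (rule limI[OF lim])
  finally show ?thesis
    using lim by (rule ssubst)
qed


section \<open>Pfaffians and the functions $Q_\lambda$\<close>

text \<open>
  Matrix indices start at 0, whence the sign \<open>(-1) ^ (j + 1)\<close>. Only even-dimensional square
  matrices are of interest; \<open>mat_delete A i j\<close> deletes row \<open>i\<close> and column \<open>j\<close>.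
\<close>

function pfaffian :: "'a :: comm_ring_1 mat \<Rightarrow> 'a" where
  "pfaffian A = (if dim_row A = 0 then 1 else
     (\<Sum>j = 1..<dim_row A. (-1) ^ (j + 1) * A $$ (0, j) * pfaffian (mat_delete (mat_delete A j j) 0 0)))"
  by auto
termination
  by (relation "Wellfounded.measure dim_row") (auto simp: mat_delete_def)

declare pfaffian.simps [simp del]

definition Q2 :: "int \<Rightarrow> int \<Rightarrow> int mfps" where
  "Q2 r s = q_sym r * q_sym s + 2 * (\<Sum>i = 1..s. (-1) ^ nat i * q_sym (r + i) * q_sym (s - i))"

definition Q_mat :: "int list \<Rightarrow> int mfps mat" where
  "Q_mat \<nu> = mat (length \<nu>) (length \<nu>) (\<lambda>(i, j).
     if i < j then Q2 (\<nu> ! i) (\<nu> ! j) else if i = j then 0 else - Q2 (\<nu> ! j) (\<nu> ! i))"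

definition Q_comp :: "int list \<Rightarrow> int mfps" where
  "Q_comp lam = (if even (length lam) then pfaffian (Q_mat lam) else pfaffian (Q_mat (lam @ [0])))"

end

(* Since Q_(r,0) = q_r and Q_(0,0) = 1, the last two columns of M(\<lambda>00) agree in every
   row but the last two. Expand Pf M(\<lambda>00) along the first row: the terms that delete one of the two
   appended zeros have the same minor M(\<lambda>_2, ..., \<lambda>_n, 0) and opposite signs, so they cancel, and
   induction turns the remaining terms into the expansion of Pf M(\<lambda>). *)
theory Submission
  imports Defs
begin

lemma q_factor_nth_0: "fps_nth (q_factor i) 0 = 1"
  by (simp add: q_factor_def)

text \<open>Every partial product has constant term 1 in z, so the sequences in
  \<open>q_gen_LIMSEQ\<close> are constant at degree 0 and equal their limits.\<close>

lemma q_sym_0: "q_sym 0 = 1"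
proof -
  have "fps_nth (\<Prod>i<N. q_factor i) 0 = 1" for N :: nat
    by (induction N) (simp_all add: q_factor_nth_0)
  hence "mfps_coeff (fps_nth q_gen 0) m = mfps_coeff 1 m" for m
    using q_gen_LIMSEQ[of 0 m] by (simp add: LIMSEQ_const_iff)
  thus ?thesis
    by (auto simp: q_sym_def intro: mfps_eqI)
qed

lemma Q2_0_right: "Q2 r 0 = q_sym r"
  by (simp add: Q2_def q_sym_0)

lemma dim_Q_mat [simp]: "dim_row (Q_mat \<nu>) = length \<nu>" "dim_col (Q_mat \<nu>) = length \<nu>"
  by (simp_all add: Q_mat_def)

text \<open>An entry depends only on two parts and on which of them comes first, and deleting an
  index preserves the order of the others.\<close>

lemma mat_delete_Q_mat:
  assumes "j < length \<nu>"
  shows "mat_delete (Q_mat \<nu>) j j = Q_mat (take j \<nu> @ drop (Suc j) \<nu>)"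
proof -
  have nth: "(take j \<nu> @ drop (Suc j) \<nu>) ! i = \<nu> ! (if i < j then i else Suc i)"
    if "i < length \<nu> - 1" for i
    using that assms by (auto simp: nth_append min_def)
  show ?thesis
    by (rule eq_matI) (use assms in \<open>auto simp: mat_delete_def Q_mat_def nth\<close>)
qed

lemma pfaffian_Q_mat_Nil: "pfaffian (Q_mat []) = 1"
  by (simp add: pfaffian.simps)

text \<open>Since minors of \<open>Q_mat\<close> are again of this form, the Pfaffian becomes a
  recursion on lists. Counting columns from the first entry of \<open>xs\<close> shifts the index by
  one and turns the sign into \<open>(-1) ^ j\<close>.\<close>

lemma pfaffian_Q_mat_Cons:
  "pfaffian (Q_mat (x # xs)) =
     (\<Sum>j<length xs. (-1) ^ j * Q2 x (xs ! j) * pfaffian (Q_mat (take j xs @ drop (Suc j) xs)))"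
proof -
  let ?A = "Q_mat (x # xs)"
  have "pfaffian ?A = (\<Sum>j = Suc 0..<Suc (length xs).
      (-1) ^ (j + 1) * ?A $$ (0, j) * pfaffian (mat_delete (mat_delete ?A j j) 0 0))"
    by (subst pfaffian.simps) simp
  also have "\<dots> = (\<Sum>j<length xs. (-1) ^ (Suc j + 1) * ?A $$ (0, Suc j) *
      pfaffian (mat_delete (mat_delete ?A (Suc j) (Suc j)) 0 0))"
    by (simp only: sum.shift_bounds_Suc_ivl atLeast0LessThan)
  also have "\<dots> = (\<Sum>j<length xs. (-1) ^ j * Q2 x (xs ! j) *
      pfaffian (Q_mat (take j xs @ drop (Suc j) xs)))"
  proof (intro sum.cong refl)
    fix j assume "j \<in> {..<length xs}"
    hence j: "j < length xs" by simp
    have "?A $$ (0, Suc j) = Q2 x (xs ! j)"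
      using j by (simp add: Q_mat_def)
    moreover have "mat_delete (mat_delete ?A (Suc j) (Suc j)) 0 0 =
        Q_mat (take j xs @ drop (Suc j) xs)"
      using j by (simp add: mat_delete_Q_mat)
    ultimately show "(-1) ^ (Suc j + 1) * ?A $$ (0, Suc j) *
        pfaffian (mat_delete (mat_delete ?A (Suc j) (Suc j)) 0 0) =
        (-1) ^ j * Q2 x (xs ! j) * pfaffian (Q_mat (take j xs @ drop (Suc j) xs))"
      by simp
  qed
  finally show ?thesis .
qed

lemma pfaffian_Q_mat_append_zeros: "pfaffian (Q_mat (xs @ [0, 0])) = pfaffian (Q_mat xs)"
\<comment> \<open>The minors delete a part from anywhere in the list, so structural induction does
  not reach them.\<close>
proof (induction xs rule: length_induct)
  case (1 xs)
  show ?case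
  proof (cases xs)
    case Nil
    thus ?thesis
      by (simp add: pfaffian_Q_mat_Cons pfaffian_Q_mat_Nil Q2_0_right q_sym_0)
  next
    case (Cons y ys)
    let ?n = "length ys"
    let ?t = "\<lambda>zs j. (-1) ^ j * Q2 y (zs ! j) * pfaffian (Q_mat (take j zs @ drop (Suc j) zs))"
    let ?zs = "ys @ [0, 0]"
    have "pfaffian (Q_mat (xs @ [0, 0])) = (\<Sum>j<?n. ?t ?zs j) + ?t ?zs ?n + ?t ?zs (Suc ?n)"
      using pfaffian_Q_mat_Cons[of y ?zs]
      by (simp only: Cons append_Cons length_append list.size add_Suc_right add_0_right
          sum.lessThan_Suc One_nat_def)
    also have "?t ?zs (Suc ?n) = - ?t ?zs ?n"
      by (simp add: nth_append)
    also have "(\<Sum>j<?n. ?t ?zs j) = (\<Sum>j<?n. ?t ys j)"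
    proof (intro sum.cong refl)
      fix j assume "j \<in> {..<?n}"
      hence j: "j < ?n" by simp
      \<comment> \<open>As \<open>j < ?n\<close>, the deleted part precedes both zeros, which stay
        at the end of a list two parts shorter than before.\<close>
      have "pfaffian (Q_mat ((take j ys @ drop (Suc j) ys) @ [0, 0])) =
          pfaffian (Q_mat (take j ys @ drop (Suc j) ys))"
        using j by (intro 1[rule_format]) (simp add: Cons)
      thus "?t ?zs j = ?t ys j"
        using j by (simp add: nth_append)
    qed
    finally show ?thesis
      by (simp add: Cons pfaffian_Q_mat_Cons)
  qed
qed

theorem proposition3p2:
  fixes lam :: "int list"
  shows "Q_comp (lam @ [0]) = Q_comp lam"
  \<comment> \<open>For odd length both sides unfold to the same Pfaffian; for even length the left
    side is padded to \<open>lam @ [0, 0]\<close>.\<close>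
  using pfaffian_Q_mat_append_zeros[of lam] by (simp add: Q_comp_def)

end
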